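(* The single-store driver-allocation POMDP with the shadow-price-penalized reward $r^\lambda(x,s,a)=r(x,s,a)-\lambda a$, defined in the context and under its standing assumptions, is indexable. That is, for every period $t\in\{1,\ldots,T\}$ and every state $(s,\mathbf{b})\in\mathbb{Z}_{\ge 0}\times\Delta^{K-1}$, the optimal driver count $\lambda\mapsto a^*_t(s,\mathbf{b};\lambda)$ is non-increasing in the shadow price $\lambda\in[0,\infty)$.
   Context: **Parameters.** $T\ge 1$ (number of periods), $K\ge 1$ (number of demand regimes), $v\in\mathbb{Z}_{>0}$ (orders per driver per period), $x_{\max}\in\mathbb{Z}_{\ge 0}$, $a_{\min}\in\mathbb{Z}_{\ge 0}$; real numbers $p,c_a,c_p,c_b,c_{\mathrm{lost}}>0$. Put $q:=p-c_p$. $\Delta^{K-1}$ is the set of probability vectors on $\{1,\ldots,K\}$. **Standing assumptions.** $vp-vc_p-c_a>0$; $q>0$ (A1); $c_b>q$ (A2); $c_{\mathrm{lost}}>c_b$; the regime transition matrix does not depend on the action (A3); the upper bound on the action is non-binding (A4), so actions are taken in $\mathcal{A}=\{a\in\mathbb{Z}: a\ge a_{\min}\}$. **Demand and beliefs.** Fix a day of week $d$. For each period $t$ (at hour $h_t$) and regime $k$, $f_k(\cdot;d,h_t)$ is a probability mass function on $\{0,1,\ldots,x_{\max}\}$. $\mathbf{T}$ is a $K\times K$ row-stochastic matrix. Given belief $\mathbf{b}$ at period $t$ and observed demand $x$, the next belief is $\mathbf{b}_{t+1}(x)=\mathbf{T}^\top\mathbf{b}^+$, where $b^+(j)=b(j)f_j(x;d,h_t)/\sum_{k}b(k)f_k(x;d,h_t)$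 (defined arbitrarily in $\Delta^{K-1}$ when the denominator is $0$; such $x$ have weight zero below). **Reward and backlog.** With backlog $s\in\mathbb{Z}_{\ge 0}$, demand $x$ and action $a$, $$r(x,s,a)=p\min\{x+s,va\}-c_a a-c_p\min\{x+s,va\}-c_b s,$$ and the next backlog is $\max\{x+s-va,0\}$. For a shadow price $\lambda\ge 0$ put $r^\lambda(x,s,a)=r(x,s,a)-\lambda a$. **Value functions at price $\lambda$.** $V_{T+1}(s,\mathbf{b};\lambda)=-c_{\mathrm{lost}}\,s$, and for $t=T,\ldots,1$, $$Q_t(s,\mathbf{b},a;\lambda)=\sum_{k=1}^K b(k)\sum_{x=0}^{x_{\max}}\Bigl[r^\lambda(x,s,a)+V_{t+1}\bigl(\max\{x+s-va,0\},\mathbf{b}_{t+1}(x);\lambda\bigr)\Bigr]f_k(x;d,h_t),$$ $V_t(s,\mathbf{b};\lambda)=\max_{a\in\mathcal{A}}Q_t(s,\mathbf{b},a;\lambda)$. The maximum is attained, since once $va\ge x_{\max}+s$ increasing $a$ only adds cost. The optimal driver count is the smallest maximizer $a^*_t(s,\mathbf{b};\lambda):=\min\bigl(\arg\max_{a\in\mathcal{A}}Q_t(s,\mathbf{b},a;\lambda)\bigr)$. *)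

theory Defs
  imports "HOL-Probability.Probability"
begin

text \<open>
  Regimes are the elements of the finite type \<open>'k\<close>, so the number of regimes is \<open>CARD('k) \<ge> 1\<close>.
  Days of the week and hours are uninterpreted (types \<open>'d\<close> and \<open>'h\<close>); the field \<open>day\<close> is the
  fixed day, and \<open>hour t\<close> is the hour of period \<open>t\<close>.
  The field \<open>fallback\<close> is the arbitrary value of the Bayes posterior at observations that have
  probability zero under the current belief.
\<close>

record ('k::finite, 'd, 'h) store =
  horizon :: nat
  orders_per_driver :: nat
  x_max :: nat
  a_min :: nat
  price :: real
  c_a :: real
  c_p :: real
  c_b :: real
  c_lost :: real
  day :: 'd
  hour :: "nat \<Rightarrow> 'h"
  demand :: "'k \<Rightarrow> 'd \<Rightarrow> 'h \<Rightarrow> nat pmf"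
  trans_matrix :: "real^'k^'k"
  fallback :: "nat \<Rightarrow> real^'k \<Rightarrow> nat \<Rightarrow> real^'k"

definition belief_simplex :: "(real^'k::finite) set" where
  "belief_simplex = {b. (\<forall>k. 0 \<le> b $ k) \<and> (\<Sum>k\<in>UNIV. b $ k) = 1}"

definition row_stochastic :: "real^'k::finite^'k \<Rightarrow> bool" where
  "row_stochastic P \<longleftrightarrow> (\<forall>i j. 0 \<le> P $ i $ j) \<and> (\<forall>i. (\<Sum>j\<in>UNIV. P $ i $ j) = 1)"

definition margin :: "('k::finite, 'd, 'h) store \<Rightarrow> real" where
  "margin M = price M - c_p M"

text \<open>
  That the regime transitions do not depend on the action is built into the type of
  \<open>trans_matrix\<close>, and that the upper bound on the action is not binding into \<open>actions\<close> below.
\<close>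

definition standing_assumptions :: "('k::finite, 'd, 'h) store \<Rightarrow> bool" where
  "standing_assumptions M \<longleftrightarrow>
     1 \<le> horizon M \<and> 0 < orders_per_driver M \<and>
     0 < price M \<and> 0 < c_a M \<and> 0 < c_p M \<and> 0 < c_b M \<and> 0 < c_lost M \<and>
     real (orders_per_driver M) * price M - real (orders_per_driver M) * c_p M - c_a M > 0 \<and>
     margin M > 0 \<and> c_b M > margin M \<and> c_lost M > c_b M \<and>
     row_stochastic (trans_matrix M) \<and>
     (\<forall>t\<in>{1..horizon M}. \<forall>k. set_pmf (demand M k (day M) (hour M t)) \<subseteq> {0..x_max M}) \<and>
     (\<forall>t b x. fallback M t b x \<in> belief_simplex)"

definition actions :: "('k::finite, 'd, 'h) store \<Rightarrow> nat set" where
  "actions M = {a_min M..}"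

definition demand_prob :: "('k::finite, 'd, 'h) store \<Rightarrow> nat \<Rightarrow> 'k \<Rightarrow> nat \<Rightarrow> real" where
  "demand_prob M t k x = pmf (demand M k (day M) (hour M t)) x"

definition posterior :: "('k::finite, 'd, 'h) store \<Rightarrow> nat \<Rightarrow> real^'k \<Rightarrow> nat \<Rightarrow> real^'k" where
  "posterior M t b x =
     (let D = (\<Sum>k\<in>UNIV. b $ k * demand_prob M t k x)
      in if D = 0 then fallback M t b x else (\<chi> j. b $ j * demand_prob M t j x / D))"

definition next_belief :: "('k::finite, 'd, 'h) store \<Rightarrow> nat \<Rightarrow> real^'k \<Rightarrow> nat \<Rightarrow> real^'k" where
  "next_belief M t b x = transpose (trans_matrix M) *v posterior M t b x"

definition reward :: "('k::finite, 'd, 'h) store \<Rightarrow> nat \<Rightarrow> nat \<Rightarrow> nat \<Rightarrow> real" where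
  "reward M x s a =
     price M * real (min (x + s) (orders_per_driver M * a)) - c_a M * real a
     - c_p M * real (min (x + s) (orders_per_driver M * a)) - c_b M * real s"

definition penalized_reward :: "('k::finite, 'd, 'h) store \<Rightarrow> real \<Rightarrow> nat \<Rightarrow> nat \<Rightarrow> nat \<Rightarrow> real" where
  "penalized_reward M l x s a = reward M x s a - l * real a"

text \<open>Subtraction on the natural numbers truncates at \<open>0\<close>, so this is \<open>max {x + s - v a, 0}\<close>.\<close>

definition next_backlog :: "('k::finite, 'd, 'h) store \<Rightarrow> nat \<Rightarrow> nat \<Rightarrow> nat \<Rightarrow> nat" where
  "next_backlog M x s a = x + s - orders_per_driver M * a"

text \<open>The one-step lookahead with an arbitrary continuation value \<open>W\<close>.\<close>

definition lookahead ::
  "('k::finite, 'd, 'h) store \<Rightarrow> real \<Rightarrow> nat \<Rightarrow> (nat \<Rightarrow> real^'k \<Rightarrow> real) \<Rightarrow> nat \<Rightarrow> real^'k \<Rightarrow> nat \<Rightarrow> real"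
where
  "lookahead M l t W s b a =
     (\<Sum>k\<in>UNIV. b $ k * (\<Sum>x=0..x_max M.
        (penalized_reward M l x s a + W (next_backlog M x s a) (next_belief M t b x))
        * demand_prob M t k x))"

text \<open>
  The action set is infinite, so the maximum is written as a supremum; lemma
  \<open>opt_drivers_maximal\<close> shows that it is attained.
\<close>

function V :: "('k::finite, 'd, 'h) store \<Rightarrow> real \<Rightarrow> nat \<Rightarrow> nat \<Rightarrow> real^'k \<Rightarrow> real" where
  "V M l t =
     (if t > horizon M then (\<lambda>s b. - c_lost M * real s)
      else (\<lambda>s b. SUP a\<in>actions M. lookahead M l t (V M l (Suc t)) s b a))"
  by pat_completeness auto
termination
  by (relation "Wellfounded.measure (\<lambda>(M, l, t). Suc (horizon M) - t)") auto

declare V.simps [simp del]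

definition Q ::
  "('k::finite, 'd, 'h) store \<Rightarrow> real \<Rightarrow> nat \<Rightarrow> nat \<Rightarrow> real^'k \<Rightarrow> nat \<Rightarrow> real"
where
  "Q M l t s b a = lookahead M l t (V M l (Suc t)) s b a"

definition opt_drivers ::
  "('k::finite, 'd, 'h) store \<Rightarrow> real \<Rightarrow> nat \<Rightarrow> nat \<Rightarrow> real^'k \<Rightarrow> nat"
where
  "opt_drivers M l t s b = (LEAST a. is_arg_max (Q M l t s b) (\<lambda>a. a \<in> actions M) a)"

definition indexable :: "('k::finite, 'd, 'h) store \<Rightarrow> bool" where
  "indexable M \<longleftrightarrow>
     (\<forall>t\<in>{1..horizon M}. \<forall>s. \<forall>b\<in>belief_simplex. antimono_on {0..} (\<lambda>l. opt_drivers M l t s b))"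

lemma V_terminal: "V M l (Suc (horizon M)) s b = - c_lost M * real s"
  by (simp add: V.simps)

lemma V_step:
  assumes "t \<le> horizon M"
  shows "V M l t s b = (SUP a\<in>actions M. Q M l t s b a)"
  using assms by (subst V.simps) (simp add: Q_def)

lemma lookahead_antimono_large:
  assumes b: "b \<in> belief_simplex" and c: "c_a M + l \<ge> 0"
    and v: "0 < orders_per_driver M" and a: "x_max M + s \<le> a" "a \<le> a'"
  shows "lookahead M l t W s b a' \<le> lookahead M l t W s b a"
proof -
  have big: "x + s \<le> orders_per_driver M * e" if "x \<le> x_max M" "a \<le> e" for x e
  proof -
    have "e \<le> orders_per_driver M * e" using v by simp
    then show ?thesis using that a by linarith
  qed
  have pr: "penalized_reward M l x s a' \<le> penalized_reward M l x s a" if "x \<le> x_max M" for x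
  proof -
    have "(c_a M + l) * real a \<le> (c_a M + l) * real a'"
      using a c by (intro mult_left_mono) auto
    then show ?thesis
      using big[OF that, of a] big[OF that, of a'] a
      by (simp add: penalized_reward_def reward_def min_absorb1 algebra_simps)
  qed
  have nb: "next_backlog M x s a' = next_backlog M x s a" if "x \<le> x_max M" for x
    using big[OF that, of a] big[OF that, of a'] a by (simp add: next_backlog_def)
  show ?thesis unfolding lookahead_def
    using b by (intro sum_mono mult_left_mono mult_right_mono)
      (auto simp: pr nb belief_simplex_def demand_prob_def)
qed

lemma Q_attains_max:
  assumes "standing_assumptions M" "b \<in> belief_simplex" "0 \<le> l"
  shows "\<exists>a. is_arg_max (Q M l t s b) (\<lambda>a. a \<in> actions M) a"
proof -
  define N where "N = a_min M + x_max M + s"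
  have fin: "finite {a_min M..N}" "{a_min M..N} \<noteq> {}" by (auto simp: N_def)
  obtain a where a: "a \<in> {a_min M..N}" "Q M l t s b a = Max (Q M l t s b ` {a_min M..N})"
    using Max_in[of "Q M l t s b ` {a_min M..N}"] fin by fastforce
  have le: "Q M l t s b e \<le> Q M l t s b a" if "e \<in> actions M" for e
  proof (cases "e \<le> N")
    case True
    then show ?thesis using that a(2) fin by (simp add: actions_def)
  next
    case False
    have "Q M l t s b e \<le> Q M l t s b N"
      unfolding Q_def using assms False
      by (intro lookahead_antimono_large) (auto simp: standing_assumptions_def N_def)
    also have "\<dots> \<le> Q M l t s b a" using a(2) fin by (simp add: N_def)
    finally show ?thesis .
  qed
  have "is_arg_max (Q M l t s b) (\<lambda>a. a \<in> actions M) a"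
    using a(1) le by (auto simp: is_arg_max_linorder actions_def)
  then show ?thesis ..
qed

lemma opt_drivers_maximal:
  assumes "standing_assumptions M" "b \<in> belief_simplex" "0 \<le> l" "t \<le> horizon M"
  shows "opt_drivers M l t s b \<in> actions M"
    and "V M l t s b = Q M l t s b (opt_drivers M l t s b)"
    and "a \<in> actions M \<Longrightarrow> Q M l t s b a \<le> V M l t s b"
proof -
  have m: "is_arg_max (Q M l t s b) (\<lambda>a. a \<in> actions M) (opt_drivers M l t s b)"
    unfolding opt_drivers_def using Q_attains_max[OF assms(1-3)] by (rule LeastI_ex)
  then show o: "opt_drivers M l t s b \<in> actions M" by (simp add: is_arg_max_def)
  show e: "V M l t s b = Q M l t s b (opt_drivers M l t s b)"
    unfolding V_step[OF assms(4)] using m by (intro cSup_eq_maximum) (auto simp: is_arg_max_linorder)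
  show "a \<in> actions M \<Longrightarrow> Q M l t s b a \<le> V M l t s b"
    using m by (auto simp: e is_arg_max_linorder)
qed

end

theory Submission
  imports Defs
begin

text \<open>
  Extend a continuation value to negative arguments \<open>x + s - v a\<close> (idle capacity) by the linear
  function of slope \<open>q = p - c\<^sub>p\<close>. Then the lookahead becomes
  \<open>(q v - c\<^sub>a - \<lambda>) a - c\<^sub>b s + G (s - v a)\<close> with \<open>G\<close> an average of shifts of the extended
  value. By backward induction the increments \<open>V (s + 1) - V s\<close> are at most \<open>q\<close> and do not grow when
  \<open>s\<close> is replaced by \<open>s + v\<close>. For prices \<open>\<lambda> \<le> \<lambda> + \<delta>\<close> with values \<open>V\<close>, \<open>V'\<close>, the difference
  \<open>V' - V\<close> is, by a second induction that uses the first, non-increasing in \<open>s\<close> but drops by at most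
  \<open>\<delta>\<close> over \<open>v\<close> steps: a larger backlog needs more drivers in total, and \<open>v\<close> further orders need at
  most one more. The latter bound says that the gain of an additional driver today is non-increasing
  in the price, hence so is the smallest maximizer.
\<close>

section \<open>Increment conditions and their iterates\<close>

text \<open>The argument type is generic because value functions take natural numbers while their
  extensions take integers.\<close>

definition slope_le :: "real \<Rightarrow> ('a::semiring_1 \<Rightarrow> real) \<Rightarrow> bool" where
  "slope_le q f \<longleftrightarrow> (\<forall>y. f (y + 1) - f y \<le> q)"

text \<open>
  Weaker than concavity, which fails for \<open>v > 1\<close> because drivers are indivisible.
\<close>

definition lag_concave :: "nat \<Rightarrow> ('a::semiring_1 \<Rightarrow> real) \<Rightarrow> bool" where
  "lag_concave v f \<longleftrightarrow> (\<forall>y. f (y + of_nat v + 1) - f (y + of_nat v) \<le> f (y + 1) - f y)"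

definition price_ordered ::
  "nat \<Rightarrow> real \<Rightarrow> ('a::semiring_1 \<Rightarrow> real) \<Rightarrow> ('a \<Rightarrow> real) \<Rightarrow> bool" where
  "price_ordered v \<delta> f f' \<longleftrightarrow>
     (\<forall>y. f' (y + 1) - f' y \<le> f (y + 1) - f y) \<and>
     (\<forall>y. f (y + of_nat v) - f y - \<delta> \<le> f' (y + of_nat v) - f' y)"

lemma lag_concave_increment:
  fixes f :: "int \<Rightarrow> real"
  assumes "lag_concave v f"
  shows "f (y + int v * int n + 1) - f (y + int v * int n) \<le> f (y + 1) - f y"
proof (induction n)
  case (Suc n)
  have "f (y + int v * int n + int v + 1) - f (y + int v * int n + int v)
      \<le> f (y + int v * int n + 1) - f (y + int v * int n)"
    using assms unfolding lag_concave_def by blast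
  then show ?case using Suc by (simp add: algebra_simps)
qed simp

text \<open>Rearranged, \<open>lag_concave\<close> says that the increment over \<open>v\<close>
  steps does not grow when \<open>y\<close> moves to \<open>y + 1\<close>; this is iterated from
  \<open>x\<close> to \<open>y\<close>.\<close>

lemma lag_concave_lag_increment:
  fixes f :: "int \<Rightarrow> real"
  assumes "lag_concave v f" "x \<le> y"
  shows "f (y + int v) - f y \<le> f (x + int v) - f x"
  using assms(2)
proof (induction y rule: int_ge_induct)
  case (step y)
  have "f (y + int v + 1) - f (y + int v) \<le> f (y + 1) - f y"
    using assms(1) unfolding lag_concave_def by blast
  then show ?case using step by (simp add: algebra_simps)
qed simp

lemma price_ordered_diff_antimono:
  fixes f f' :: "int \<Rightarrow> real"
  assumes "price_ordered v \<delta> f f'" "x \<le> y"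
  shows "f' y - f y \<le> f' x - f x"
  using assms(2)
proof (induction y rule: int_ge_induct)
  case (step y)
  have "f' (y + 1) - f' y \<le> f (y + 1) - f y"
    using assms(1) unfolding price_ordered_def by blast
  then show ?case using step by linarith
qed simp

lemma price_ordered_lag:
  fixes f f' :: "int \<Rightarrow> real"
  assumes "price_ordered v \<delta> f f'"
  shows "f (y + int v * int n) - f y - real n * \<delta> \<le> f' (y + int v * int n) - f' y"
proof (induction n)
  case (Suc n)
  have "f (y + int v * int n + int v) - f (y + int v * int n) - \<delta>
      \<le> f' (y + int v * int n + int v) - f' (y + int v * int n)"
    using assms unfolding price_ordered_def by blast
  then show ?case using Suc by (simp add: algebra_simps)
qed simp

section \<open>Extension to idle capacity\<close>

definition left_extend :: "real \<Rightarrow> (nat \<Rightarrow> real) \<Rightarrow> int \<Rightarrow> real" where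
  "left_extend q W z = q * min (real_of_int z) 0 + W (nat z)"

lemma left_extend_nonneg [simp]: "left_extend q W (int n) = W n"
  by (simp add: left_extend_def)

lemma left_extend_nonpos: "z \<le> 0 \<Longrightarrow> left_extend q W z = q * real_of_int z + W 0"
  by (simp add: left_extend_def)

lemma slope_le_left_extend:
  assumes "slope_le q W"
  shows "slope_le q (left_extend q W)"
  unfolding slope_le_def
proof
  fix y :: int
  show "left_extend q W (y + 1) - left_extend q W y \<le> q"
  proof (cases "0 \<le> y")
    case True
    then obtain n where n: "y = int n" by (metis nonneg_int_cases)
    then have "y + 1 = int (n + 1)" by simp
    then show ?thesis using assms n unfolding slope_le_def by (metis left_extend_nonneg)
  next
    case False
    then show ?thesis by (simp add: left_extend_nonpos algebra_simps)
  qed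
qed

text \<open>To the left of 0 the unit increment equals \<open>q\<close>, the largest that
  \<open>slope_le\<close> allows anywhere. This is the purpose of the slope bound.\<close>

lemma lag_concave_left_extend:
  assumes "slope_le q W" "lag_concave v W"
  shows "lag_concave v (left_extend q W)"
  unfolding lag_concave_def
proof
  fix y :: int
  show "left_extend q W (y + of_nat v + 1) - left_extend q W (y + of_nat v)
      \<le> left_extend q W (y + 1) - left_extend q W y"
  proof (cases "0 \<le> y")
    case True
    then obtain n where n: "y = int n" by (metis nonneg_int_cases)
    have "W (n + v + 1) - W (n + v) \<le> W (n + 1) - W n"
      using assms(2) unfolding lag_concave_def by (metis of_nat_id)
    then show ?thesis
      using left_extend_nonneg[of q W "n + v + 1"] left_extend_nonneg[of q W "n + v"]
        left_extend_nonneg[of q W "n + 1"]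
      by (simp add: n algebra_simps)
  next
    case False
    then have "left_extend q W (y + 1) - left_extend q W y = q"
      by (simp add: left_extend_nonpos algebra_simps)
    then show ?thesis using slope_le_left_extend[OF assms(1)] unfolding slope_le_def by metis
  qed
qed

text \<open>Both extensions have the same linear part, so their difference at \<open>z\<close> is
  \<open>W' - W\<close> at \<open>nat z\<close>, which is constant to the left of 0.\<close>

lemma price_ordered_left_extend:
  assumes "price_ordered v \<delta> W W'" "0 \<le> \<delta>"
  shows "price_ordered v \<delta> (left_extend q W) (left_extend q W')"
proof -
  have unit: "W' (n + 1) - W' n \<le> W (n + 1) - W n" for n
    using assms(1) unfolding price_ordered_def by blast
  have anti: "W' n - W n \<le> W' m - W m" if "m \<le> n" for m n
    using that
  proof (induction n rule: dec_induct)
    case (step n)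
    then show ?case using unit[of n] by simp
  qed simp
  have lag: "W (n + v) - W n - \<delta> \<le> W' (n + v) - W' n" for n
    using assms(1) unfolding price_ordered_def by (metis of_nat_id)
  have "left_extend q W' (y + 1) - left_extend q W' y \<le> left_extend q W (y + 1) - left_extend q W y" for y
    using anti[OF nat_mono[of y "y + 1"]] by (simp add: left_extend_def)
  moreover have "left_extend q W (y + int v) - left_extend q W y - \<delta>
      \<le> left_extend q W' (y + int v) - left_extend q W' y" for y
  proof (cases "0 \<le> y")
    case True
    then show ?thesis using lag[of "nat y"] by (simp add: left_extend_def nat_add_distrib)
  next
    case False
    \<comment> \<open>Since \<open>nat y = 0\<close>, the difference moves from 0 to at most
      \<open>v\<close>; being non-increasing, it drops no more than on the full way from 0 to
      \<open>v\<close>.\<close>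
    then have "nat (y + int v) \<le> v" by linarith
    then show ?thesis
      using False lag[of 0] anti[of "nat (y + int v)" v] by (simp add: left_extend_def)
  qed
  ultimately show ?thesis unfolding price_ordered_def by simp
qed

section \<open>Averaging over the demand\<close>

text \<open>The family \<open>F\<close> is indexed by the demand because observing \<open>x\<close>
  also changes the belief at which the next value is taken.\<close>

definition mixture :: "nat \<Rightarrow> (nat \<Rightarrow> real) \<Rightarrow> (nat \<Rightarrow> int \<Rightarrow> real) \<Rightarrow> int \<Rightarrow> real" where
  "mixture N w F y = (\<Sum>x=0..N. w x * F x (int x + y))"

lemma mixture_diff:
  "mixture N w F y - mixture N w F z = (\<Sum>x=0..N. w x * (F x (int x + y) - F x (int x + z)))"
  by (simp add: mixture_def sum_subtractf right_diff_distrib)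

lemma slope_le_mixture:
  assumes w: "\<And>x. 0 \<le> w x" "(\<Sum>x=0..N. w x) = 1" and F: "\<And>x. slope_le q (F x)"
  shows "slope_le q (mixture N w F)"
  unfolding slope_le_def
proof
  fix y
  have "mixture N w F (y + 1) - mixture N w F y \<le> (\<Sum>x=0..N. w x * q)"
    unfolding mixture_diff
  proof (intro sum_mono mult_left_mono w)
    fix x
    show "F x (int x + (y + 1)) - F x (int x + y) \<le> q"
      using F[of x, unfolded slope_le_def, THEN spec, of "int x + y"] by (simp add: ac_simps)
  qed
  then show "mixture N w F (y + 1) - mixture N w F y \<le> q"
    using w(2) by (simp flip: sum_distrib_right)
qed

lemma lag_concave_mixture:
  assumes w: "\<And>x. 0 \<le> w x" and F: "\<And>x. lag_concave v (F x)"
  shows "lag_concave v (mixture N w F)"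
  unfolding lag_concave_def mixture_diff
proof (intro allI sum_mono mult_left_mono w)
  fix y x
  show "F x (int x + (y + of_nat v + 1)) - F x (int x + (y + of_nat v))
      \<le> F x (int x + (y + 1)) - F x (int x + y)"
    using F[of x, unfolded lag_concave_def, THEN spec, of "int x + y"] by (simp add: ac_simps)
qed

lemma price_ordered_mixture:
  assumes w: "\<And>x. 0 \<le> w x" "(\<Sum>x=0..N. w x) = 1"
    and F: "\<And>x. price_ordered v \<delta> (F x) (F' x)"
  shows "price_ordered v \<delta> (mixture N w F) (mixture N w F')"
proof -
  have "mixture N w F' (y + 1) - mixture N w F' y \<le> mixture N w F (y + 1) - mixture N w F y" for y
    unfolding mixture_diff
  proof (intro sum_mono mult_left_mono w)
    fix x
    show "F' x (int x + (y + 1)) - F' x (int x + y) \<le> F x (int x + (y + 1)) - F x (int x + y)"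
      using F[of x, unfolded price_ordered_def, THEN conjunct1, THEN spec, of "int x + y"]
      by (simp add: ac_simps)
  qed
  moreover have "mixture N w F (y + of_nat v) - mixture N w F y - \<delta>
      \<le> mixture N w F' (y + of_nat v) - mixture N w F' y" for y
  proof -
    have "(\<Sum>x=0..N. w x * (F x (int x + (y + of_nat v)) - F x (int x + y) - \<delta>))
        \<le> mixture N w F' (y + of_nat v) - mixture N w F' y"
      unfolding mixture_diff
    proof (intro sum_mono mult_left_mono w)
      fix x
      show "F x (int x + (y + of_nat v)) - F x (int x + y) - \<delta>
          \<le> F' x (int x + (y + of_nat v)) - F' x (int x + y)"
        using F[of x, unfolded price_ordered_def, THEN conjunct2, THEN spec, of "int x + y"]
        by (simp add: ac_simps)
    qed
    moreover have "(\<Sum>x=0..N. w x * (F x (int x + (y + of_nat v)) - F x (int x + y) - \<delta>))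
        = mixture N w F (y + of_nat v) - mixture N w F y - (\<Sum>x=0..N. w x) * \<delta>"
      by (simp add: mixture_diff right_diff_distrib sum_subtractf sum_distrib_right)
    ultimately show ?thesis using w(2) by simp
  qed
  ultimately show ?thesis unfolding price_ordered_def by blast
qed

section \<open>Maximization in a single period\<close>

text \<open>One period stripped of beliefs: \<open>\<beta>\<close> is the net gain per driver,
  \<open>c\<close> the backlog cost, \<open>m\<close> the least admissible count, and
  \<open>\<alpha>\<close> any selection of maximizers.\<close>

definition optimal ::
  "nat \<Rightarrow> nat \<Rightarrow> real \<Rightarrow> real \<Rightarrow> (int \<Rightarrow> real) \<Rightarrow> (nat \<Rightarrow> real) \<Rightarrow> (nat \<Rightarrow> nat) \<Rightarrow> bool" where
  "optimal v m \<beta> c G W \<alpha> \<longleftrightarrow>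
     (\<forall>s. m \<le> \<alpha> s \<and> W s = \<beta> * real (\<alpha> s) - c * real s + G (int s - int v * int (\<alpha> s)) \<and>
          (\<forall>a\<ge>m. \<beta> * real a - c * real s + G (int s - int v * int a) \<le> W s))"

lemma optimalD:
  assumes "optimal v m \<beta> c G W \<alpha>"
  shows "m \<le> \<alpha> s"
    and "W s = \<beta> * real (\<alpha> s) - c * real s + G (int s - int v * int (\<alpha> s))"
    and "m \<le> a \<Longrightarrow> \<beta> * real a - c * real s + G (int s - int v * int a) \<le> W s"
  using assms unfolding optimal_def by blast+

text \<open>Using the maximizer for \<open>s + 1\<close> also at \<open>s\<close> leaves one
  increment of \<open>G\<close> and the backlog cost, which only helps.\<close>

lemma slope_le_optimal:
  assumes opt: "optimal v m \<beta> c G W \<alpha>" and "slope_le q G" "0 \<le> c"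
  shows "slope_le q W"
  unfolding slope_le_def
proof
  fix s
  define a where "a = \<alpha> (s + 1)"
  have "G (int s - int v * int a + 1) - G (int s - int v * int a) \<le> q"
    using assms(2) unfolding slope_le_def by blast
  moreover have "int s - int v * int a + 1 = int (s + 1) - int v * int a" by simp
  moreover have "\<beta> * real a - c * real s + G (int s - int v * int a) \<le> W s"
    using optimalD[OF opt] by (simp add: a_def)
  ultimately show "W (s + 1) - W s \<le> q"
    using optimalD(2)[OF opt, of "s + 1"] \<open>0 \<le> c\<close> by (simp add: a_def algebra_simps)
qed

text \<open>Exchange argument: the maximizers at \<open>s + v + 1\<close> and \<open>s\<close> are
  turned into admissible counts at \<open>s + 1\<close> and \<open>s + v\<close> of at least the
  same total value.\<close>

lemma lag_concave_optimal:
  assumes opt: "optimal v m \<beta> c G W \<alpha>" and G: "lag_concave v G"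
  shows "lag_concave v W"
  unfolding lag_concave_def of_nat_id
proof
  fix s
  define a where "a = \<alpha> (s + v + 1)"
  define e where "e = \<alpha> s"
  have am: "m \<le> a" "m \<le> e" using optimalD(1)[OF opt] by (simp_all add: a_def e_def)
  have Wa: "W (s + v + 1) = \<beta> * real a - c * real (s + v + 1) + G (int (s + v + 1) - int v * int a)"
    and We: "W s = \<beta> * real e - c * real s + G (int s - int v * int e)"
    using optimalD(2)[OF opt] by (simp_all add: a_def e_def)
  show "W (s + v + 1) - W (s + v) \<le> W (s + 1) - W s"
  proof (cases "m < a")
    case True
    \<comment> \<open>One driver moves: \<open>a - 1\<close> at \<open>s + 1\<close> and
      \<open>e + 1\<close> at \<open>s + v\<close> give the same two arguments of \<open>G\<close>
      as before.\<close>
    then obtain d where d: "a = Suc d" "m \<le> d" by (cases a) auto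
    have "\<beta> * real d - c * real (s + 1) + G (int (s + 1) - int v * int d) \<le> W (s + 1)"
      using optimalD(3)[OF opt] d(2) .
    moreover have "\<beta> * real (Suc e) - c * real (s + v) + G (int (s + v) - int v * int (Suc e))
        \<le> W (s + v)"
      using optimalD(3)[OF opt, of "Suc e" "s + v"] am by simp
    ultimately show ?thesis using Wa We by (simp add: d algebra_simps)
  next
    case False
    then have am': "a \<le> e" using am by simp
    have "\<beta> * real e - c * real (s + 1) + G (int (s + 1) - int v * int e) \<le> W (s + 1)"
      using optimalD(3)[OF opt] am(2) .
    moreover have "\<beta> * real a - c * real (s + v) + G (int (s + v) - int v * int a) \<le> W (s + v)"
      using optimalD(3)[OF opt] am(1) .
    \<comment> \<open>Now \<open>a = m\<close> and both counts are kept. The arguments differ by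
      \<open>v * (e + 1 - a)\<close>, a multiple of \<open>v\<close>.\<close>
    moreover have "G (int (s + v) - int v * int a + 1) - G (int (s + v) - int v * int a)
        \<le> G (int s - int v * int e + 1) - G (int s - int v * int e)"
      using lag_concave_increment[OF G, of "int s - int v * int e" "Suc e - a"] am'
      by (simp add: algebra_simps)
    ultimately show ?thesis using Wa We by (simp add: algebra_simps)
  qed
qed

text \<open>The same exchange across two prices: one maximizer at each price is converted into
  admissible counts for the two values on the larger side of the inequality.\<close>

lemma price_ordered_optimal:
  assumes opt: "optimal v m \<beta> c G W \<alpha>" and opt': "optimal v m (\<beta> - \<delta>) c G' W' \<alpha>'"
    and G: "lag_concave v G" and GG': "price_ordered v \<delta> G G'"
  shows "price_ordered v \<delta> W W'"
  unfolding price_ordered_def of_nat_id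
proof (intro conjI allI)
  fix s
  define a where "a = \<alpha>' (s + 1)"
  define e where "e = \<alpha> s"
  have am: "m \<le> a" "m \<le> e"
    using optimalD(1)[OF opt] optimalD(1)[OF opt'] by (simp_all add: a_def e_def)
  have Wa: "W' (s + 1) = (\<beta> - \<delta>) * real a - c * real (s + 1) + G' (int (s + 1) - int v * int a)"
    using optimalD(2)[OF opt'] by (simp add: a_def)
  have We: "W s = \<beta> * real e - c * real s + G (int s - int v * int e)"
    using optimalD(2)[OF opt] by (simp add: e_def)
  show "W' (s + 1) - W' s \<le> W (s + 1) - W s"
  proof (cases "e \<le> a")
    case True
    \<comment> \<open>The counts trade prices. Using \<open>e\<close> instead of \<open>a\<close> at
      the higher price saves \<open>(a - e) * \<delta>\<close>, which covers the drop of
      \<open>G' - G\<close> over \<open>v * (a - e)\<close> steps.\<close>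
    have 1: "(\<beta> - \<delta>) * real e - c * real s + G' (int s - int v * int e) \<le> W' s"
      using optimalD(3)[OF opt'] am(2) .
    have 2: "\<beta> * real a - c * real (s + 1) + G (int (s + 1) - int v * int a) \<le> W (s + 1)"
      using optimalD(3)[OF opt] am(1) .
    define y where "y = int s - int v * int a"
    have y: "int s - int v * int e = y + int v * int (a - e)"
      using True by (simp add: y_def algebra_simps)
    have "G' (y + 1) - G (y + 1) \<le> G' y - G y"
      using price_ordered_diff_antimono[OF GG'] by simp
    moreover have "G (y + int v * int (a - e)) - G y - real (a - e) * \<delta>
        \<le> G' (y + int v * int (a - e)) - G' y"
      by (rule price_ordered_lag[OF GG'])
    moreover have "int (s + 1) - int v * int a = y + 1" by (simp add: y_def)
    moreover have "real (a - e) = real a - real e" using True by simp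
    ultimately show ?thesis using 1 2 Wa We unfolding y by (simp add: algebra_simps)
  next
    case False
    \<comment> \<open>Each count stays with its price. The increment of \<open>G'\<close> at
      \<open>z\<close> is at most that of \<open>G\<close> at \<open>z\<close>, hence at most that
      of \<open>G\<close> at \<open>y\<close>, a multiple of \<open>v\<close> below.\<close>
    have 1: "(\<beta> - \<delta>) * real a - c * real s + G' (int s - int v * int a) \<le> W' s"
      using optimalD(3)[OF opt'] am(1) .
    have 2: "\<beta> * real e - c * real (s + 1) + G (int (s + 1) - int v * int e) \<le> W (s + 1)"
      using optimalD(3)[OF opt] am(2) .
    define y where "y = int s - int v * int e"
    define z where "z = int s - int v * int a"
    have z: "z = y + int v * int (e - a)"
      using False by (simp add: y_def z_def algebra_simps)
    have "G' (z + 1) - G (z + 1) \<le> G' z - G z"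
      using price_ordered_diff_antimono[OF GG'] by simp
    moreover have "G (z + 1) - G z \<le> G (y + 1) - G y"
      unfolding z by (rule lag_concave_increment[OF G])
    moreover have eqs: "int (s + 1) - int v * int a = z + 1" "int (s + 1) - int v * int e = y + 1"
      by (simp_all add: y_def z_def)
    ultimately show ?thesis
      using 1 2 Wa We unfolding eqs y_def[symmetric] z_def[symmetric] by (simp add: algebra_simps)
  qed
next
  fix s
  define a where "a = \<alpha>' s"
  define e where "e = \<alpha> (s + v)"
  have am: "m \<le> a" "m \<le> e"
    using optimalD(1)[OF opt] optimalD(1)[OF opt'] by (simp_all add: a_def e_def)
  have Wa: "W' s = (\<beta> - \<delta>) * real a - c * real s + G' (int s - int v * int a)"
    using optimalD(2)[OF opt'] by (simp add: a_def)
  have We: "W (s + v) = \<beta> * real e - c * real (s + v) + G (int (s + v) - int v * int e)"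
    using optimalD(2)[OF opt] by (simp add: e_def)
  show "W (s + v) - W s - \<delta> \<le> W' (s + v) - W' s"
  proof (cases "m < e")
    case True
    \<comment> \<open>One driver moves from the lower price to the higher; the arguments of
      \<open>G\<close> and \<open>G'\<close> do not change, and the extra charge is exactly
      \<open>\<delta>\<close>.\<close>
    then obtain d where d: "e = Suc d" "m \<le> d" by (cases e) auto
    have "(\<beta> - \<delta>) * real (Suc a) - c * real (s + v) + G' (int (s + v) - int v * int (Suc a))
        \<le> W' (s + v)"
      using optimalD(3)[OF opt', of "Suc a" "s + v"] am by simp
    moreover have "\<beta> * real d - c * real s + G (int s - int v * int d) \<le> W s"
      using optimalD(3)[OF opt] d(2) .
    ultimately show ?thesis using Wa We by (simp add: d algebra_simps)
  next
    case False
    \<comment> \<open>Here \<open>e = m\<close>, so no driver can be removed and both counts are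
      kept; lag concavity of \<open>G\<close> compares the \<open>v\<close>-step increments at
      \<open>z\<close> and \<open>y\<close>.\<close>
    then have ea: "e \<le> a" using am by simp
    define y where "y = int s - int v * int a"
    define z where "z = int s - int v * int e"
    have "y \<le> z" using ea by (simp add: y_def z_def mult_left_mono)
    then have "G (z + int v) - G z \<le> G (y + int v) - G y"
      by (rule lag_concave_lag_increment[OF G])
    moreover have "G (y + int v) - G y - \<delta> \<le> G' (y + int v) - G' y"
      using price_ordered_lag[OF GG', of y 1] by simp
    moreover have 1: "(\<beta> - \<delta>) * real a - c * real (s + v) + G' (int (s + v) - int v * int a)
        \<le> W' (s + v)"
      using optimalD(3)[OF opt'] am(1) .
    moreover have 2: "\<beta> * real e - c * real s + G (int s - int v * int e) \<le> W s"
      using optimalD(3)[OF opt] am(2) .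
    moreover have eqs: "int (s + v) - int v * int a = y + int v"
      "int (s + v) - int v * int e = z + int v"
      by (simp_all add: y_def z_def)
    ultimately show ?thesis
      using Wa We unfolding eqs y_def[symmetric] z_def[symmetric] by (simp add: algebra_simps)
  qed
qed

section \<open>Observation probabilities and belief updates\<close>

definition obs_prob :: "('k::finite, 'd, 'h) store \<Rightarrow> nat \<Rightarrow> real^'k \<Rightarrow> nat \<Rightarrow> real" where
  "obs_prob M t b x = (\<Sum>k\<in>UNIV. b $ k * demand_prob M t k x)"

lemma obs_prob_nonneg: "b \<in> belief_simplex \<Longrightarrow> 0 \<le> obs_prob M t b x"
  by (auto simp: obs_prob_def belief_simplex_def demand_prob_def intro!: sum_nonneg)

lemma sum_obs_prob:
  assumes "standing_assumptions M" "b \<in> belief_simplex" "t \<in> {1..horizon M}"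
  shows "(\<Sum>x=0..x_max M. obs_prob M t b x) = 1"
proof -
  have "(\<Sum>x=0..x_max M. demand_prob M t k x) = 1" for k
    unfolding demand_prob_def using assms(1,3)
    by (intro sum_pmf_eq_1) (auto simp: standing_assumptions_def)
  then have "(\<Sum>k\<in>UNIV. b $ k * (\<Sum>x=0..x_max M. demand_prob M t k x)) = 1"
    using assms(2) by (simp add: belief_simplex_def)
  then show ?thesis
    unfolding obs_prob_def sum_distrib_left by (subst sum.swap)
qed

lemma posterior_in_simplex:
  assumes "standing_assumptions M" "b \<in> belief_simplex"
  shows "posterior M t b x \<in> belief_simplex"
proof (cases "obs_prob M t b x = 0")
  case True
  then show ?thesis
    using assms(1) by (simp add: posterior_def obs_prob_def standing_assumptions_def)
next
  case False
  then have "posterior M t b x = (\<chi> j. b $ j * demand_prob M t j x / obs_prob M t b x)"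
    by (simp add: posterior_def obs_prob_def)
  moreover have "(\<Sum>j\<in>UNIV. b $ j * demand_prob M t j x / obs_prob M t b x) = 1"
    using False by (simp add: obs_prob_def flip: sum_divide_distrib)
  ultimately show ?thesis
    using assms(2) obs_prob_nonneg[OF assms(2), of M t x]
    by (auto simp: belief_simplex_def demand_prob_def)
qed

lemma next_belief_in_simplex:
  assumes "standing_assumptions M" "b \<in> belief_simplex"
  shows "next_belief M t b x \<in> belief_simplex"
proof -
  define P where "P = trans_matrix M"
  define u where "u = posterior M t b x"
  have u: "u \<in> belief_simplex" using posterior_in_simplex[OF assms] by (simp add: u_def)
  have P: "0 \<le> P $ i $ j" "(\<Sum>j\<in>UNIV. P $ i $ j) = 1" for i j
    using assms(1) by (auto simp: standing_assumptions_def row_stochastic_def P_def)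
  have nth: "next_belief M t b x $ j = (\<Sum>i\<in>UNIV. u $ i * P $ i $ j)" for j
    by (simp add: next_belief_def matrix_vector_mult_def transpose_def u_def P_def mult.commute)
  have "(\<Sum>j\<in>UNIV. next_belief M t b x $ j) = (\<Sum>i\<in>UNIV. u $ i * (\<Sum>j\<in>UNIV. P $ i $ j))"
    unfolding nth sum_distrib_left by (rule sum.swap)
  also have "\<dots> = 1" using u by (simp add: P belief_simplex_def)
  finally show ?thesis
    using u P by (auto simp: belief_simplex_def nth intro!: sum_nonneg)
qed

section \<open>Reduction of the lookahead to the single-period form\<close>

definition continuation ::
  "('k::finite, 'd, 'h) store \<Rightarrow> nat \<Rightarrow> (nat \<Rightarrow> real^'k \<Rightarrow> real) \<Rightarrow> real^'k \<Rightarrow> int \<Rightarrow> real"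
where
  "continuation M t W b =
     mixture (x_max M) (obs_prob M t b) (\<lambda>x. left_extend (margin M) (\<lambda>s. W s (next_belief M t b x)))"

text \<open>The net gain of a driver whose whole capacity is used; the correction for idle capacity
  sits in \<open>left_extend\<close>.\<close>

definition driver_gain :: "('k::finite, 'd, 'h) store \<Rightarrow> real \<Rightarrow> real" where
  "driver_gain M l = margin M * real (orders_per_driver M) - c_a M - l"

lemma lookahead_eq_continuation:
  assumes "standing_assumptions M" "b \<in> belief_simplex" "t \<in> {1..horizon M}"
  shows "lookahead M l t W s b a = driver_gain M l * real a - c_b M * real s
           + continuation M t W b (int s - int (orders_per_driver M) * int a)"
proof -
  let ?v = "orders_per_driver M"
  let ?E = "\<lambda>x. left_extend (margin M) (\<lambda>s. W s (next_belief M t b x))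
                  (int x + (int s - int ?v * int a))"
  have term_eq: "penalized_reward M l x s a + W (next_backlog M x s a) (next_belief M t b x)
      = driver_gain M l * real a - c_b M * real s + ?E x" for x
  proof -
    have "nat (int x + (int s - int ?v * int a)) = x + s - ?v * a"
      by (simp add: nat_diff_distrib' nat_eq_iff flip: of_nat_mult of_nat_add)
    \<comment> \<open>The served orders are the full capacity less the idle part, which matches the
      linear term of \<open>left_extend\<close>.\<close>
    moreover have "real (min (x + s) (?v * a))
        = real ?v * real a + min (real_of_int (int x + (int s - int ?v * int a))) 0"
      by (simp add: min_def flip: of_nat_mult of_nat_add)
    ultimately show ?thesis
      by (simp add: left_extend_def penalized_reward_def reward_def next_backlog_def driver_gain_def
          margin_def algebra_simps)
  qed
  have split: "(\<Sum>x=0..x_max M. (r + ?E x) * obs_prob M t b x)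
      = r * (\<Sum>x=0..x_max M. obs_prob M t b x) + (\<Sum>x=0..x_max M. obs_prob M t b x * ?E x)" for r
    by (simp add: algebra_simps sum.distrib sum_distrib_left)
  have "lookahead M l t W s b a
      = (\<Sum>x=0..x_max M. (driver_gain M l * real a - c_b M * real s + ?E x) * obs_prob M t b x)"
    unfolding lookahead_def term_eq obs_prob_def sum_distrib_left
    by (subst sum.swap) (simp add: mult_ac)
  also have "\<dots> = (driver_gain M l * real a - c_b M * real s) * (\<Sum>x=0..x_max M. obs_prob M t b x)
      + (\<Sum>x=0..x_max M. obs_prob M t b x * ?E x)"
    by (rule split)
  finally show ?thesis
    by (simp add: sum_obs_prob[OF assms] continuation_def mixture_def)
qed

lemma Q_eq_continuation:
  assumes "standing_assumptions M" "b \<in> belief_simplex" "t \<in> {1..horizon M}"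
  shows "Q M l t s b a = driver_gain M l * real a - c_b M * real s
           + continuation M t (V M l (Suc t)) b (int s - int (orders_per_driver M) * int a)"
  unfolding Q_def by (rule lookahead_eq_continuation[OF assms])

lemma V_optimal:
  assumes "standing_assumptions M" "b \<in> belief_simplex" "t \<in> {1..horizon M}" "0 \<le> l"
  shows "optimal (orders_per_driver M) (a_min M) (driver_gain M l) (c_b M)
           (continuation M t (V M l (Suc t)) b) (\<lambda>s. V M l t s b) (\<lambda>s. opt_drivers M l t s b)"
  using opt_drivers_maximal[OF assms(1,2,4), of t] assms(3)
  unfolding optimal_def by (simp add: actions_def flip: Q_eq_continuation[OF assms(1-3)])

lemma continuation_regular:
  assumes "standing_assumptions M" "b \<in> belief_simplex" "t \<in> {1..horizon M}"
    and "\<And>u. u \<in> belief_simplex \<Longrightarrow> slope_le (margin M) (\<lambda>s. W s u) \<and> lag_concave v (\<lambda>s. W s u)"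
  shows "slope_le (margin M) (continuation M t W b)" "lag_concave v (continuation M t W b)"
proof -
  have W: "slope_le (margin M) (\<lambda>s. W s (next_belief M t b x))"
    "lag_concave v (\<lambda>s. W s (next_belief M t b x))" for x
    using assms(4)[OF next_belief_in_simplex[OF assms(1,2)]] by auto
  show "slope_le (margin M) (continuation M t W b)"
    unfolding continuation_def
    by (intro slope_le_mixture slope_le_left_extend obs_prob_nonneg sum_obs_prob W assms(1-3))
  show "lag_concave v (continuation M t W b)"
    unfolding continuation_def
    by (intro lag_concave_mixture lag_concave_left_extend obs_prob_nonneg W assms(2))
qed

lemma continuation_price_ordered:
  assumes "standing_assumptions M" "b \<in> belief_simplex" "t \<in> {1..horizon M}" "0 \<le> \<delta>"
    and "\<And>u. u \<in> belief_simplex \<Longrightarrow> price_ordered v \<delta> (\<lambda>s. W s u) (\<lambda>s. W' s u)"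
  shows "price_ordered v \<delta> (continuation M t W b) (continuation M t W' b)"
  unfolding continuation_def
  by (intro price_ordered_mixture price_ordered_left_extend obs_prob_nonneg sum_obs_prob
      next_belief_in_simplex assms)

section \<open>Backward inductions over the periods\<close>

lemma V_regular:
  assumes "standing_assumptions M" "0 \<le> l" "t \<le> Suc (horizon M)" "1 \<le> t" "b \<in> belief_simplex"
  shows "slope_le (margin M) (\<lambda>s. V M l t s b) \<and> lag_concave (orders_per_driver M) (\<lambda>s. V M l t s b)"
  using assms(3-5)
proof (induction arbitrary: b rule: inc_induct)
  case base
  show ?case
    \<comment> \<open>The terminal value is linear with slope \<open>- c_lost M\<close>, which is
      negative and so below the margin.\<close>
    using assms(1)
    by (auto simp: V_terminal slope_le_def lag_concave_def standing_assumptions_def algebra_simps)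
next
  case (step t)
  then have t: "t \<in> {1..horizon M}" by simp
  note reg = continuation_regular[OF assms(1) step.prems(2) t step.IH]
  note opt = V_optimal[OF assms(1) step.prems(2) t assms(2)]
  show ?case
    using slope_le_optimal[OF opt reg(1)] lag_concave_optimal[OF opt reg(2)] assms(1)
    by (simp add: standing_assumptions_def)
qed

lemma V_price_ordered:
  assumes "standing_assumptions M" "0 \<le> l" "0 \<le> \<delta>" "t \<le> Suc (horizon M)" "1 \<le> t"
    "b \<in> belief_simplex"
  shows "price_ordered (orders_per_driver M) \<delta> (\<lambda>s. V M l t s b) (\<lambda>s. V M (l + \<delta>) t s b)"
  using assms(4-6)
proof (induction arbitrary: b rule: inc_induct)
  case base
  show ?case using assms(3) by (simp add: V_terminal price_ordered_def)
next
  case (step t)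
  then have t: "t \<in> {1..horizon M}" by simp
  have gain: "driver_gain M (l + \<delta>) = driver_gain M l - \<delta>" by (simp add: driver_gain_def)
  \<comment> \<open>The exchange argument takes lag concavity from the continuation at the lower
    price \<open>l\<close>.\<close>
  have reg: "lag_concave (orders_per_driver M) (continuation M t (V M l (Suc t)) b)"
    using t by (intro continuation_regular(2)[OF assms(1) step.prems(2)] V_regular assms) auto
  have ord: "price_ordered (orders_per_driver M) \<delta>
      (continuation M t (V M l (Suc t)) b) (continuation M t (V M (l + \<delta>) (Suc t)) b)"
    using step.IH by (intro continuation_price_ordered[OF assms(1) step.prems(2) t assms(3)]) simp
  show ?case
    using V_optimal[OF assms(1) step.prems(2) t assms(2)]
      V_optimal[OF assms(1) step.prems(2) t, of "l + \<delta>"] assms(2,3) reg ord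
    unfolding gain by (auto intro: price_ordered_optimal)
qed

section \<open>Monotonicity of the smallest maximizer\<close>

text \<open>The added drivers cost \<open>(a' - a) * (l' - l)\<close> more at the higher price. They
  lower the argument of the continuation by \<open>v * (a' - a)\<close>, and by
  \<open>price_ordered_lag\<close> the relative gain there is at most the same amount.\<close>

lemma Q_decreasing_differences:
  assumes "standing_assumptions M" "b \<in> belief_simplex" "t \<in> {1..horizon M}" "0 \<le> l" "l \<le> l'"
    and "a \<le> a'"
  shows "Q M l' t s b a' - Q M l' t s b a \<le> Q M l t s b a' - Q M l t s b a"
proof -
  let ?v = "orders_per_driver M" and ?\<delta> = "l' - l"
  let ?G = "continuation M t (V M l (Suc t)) b" and ?G' = "continuation M t (V M l' (Suc t)) b"
  have "price_ordered ?v ?\<delta> (\<lambda>s. V M l (Suc t) s u) (\<lambda>s. V M l' (Suc t) s u)"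
    if "u \<in> belief_simplex" for u
    using V_price_ordered[OF assms(1,4), of ?\<delta> "Suc t" u] that assms(3,5) by simp
  then have ord: "price_ordered ?v ?\<delta> ?G ?G'"
    using assms by (intro continuation_price_ordered) auto
  define y where "y = int s - int ?v * int a'"
  have y: "int s - int ?v * int a = y + int ?v * int (a' - a)"
    using assms(6) by (simp add: y_def algebra_simps)
  have "?G (y + int ?v * int (a' - a)) - ?G y - (real a' - real a) * ?\<delta>
      \<le> ?G' (y + int ?v * int (a' - a)) - ?G' y"
    using price_ordered_lag[OF ord, of y "a' - a"] assms(6) by simp
  then show ?thesis
    unfolding Q_eq_continuation[OF assms(1-3)] y y_def[symmetric]
    by (simp add: driver_gain_def algebra_simps)
qed

lemma opt_drivers_le:
  assumes "standing_assumptions M" "b \<in> belief_simplex" "0 \<le> l" "t \<le> horizon M"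
    and "a \<in> actions M" "Q M l t s b (opt_drivers M l t s b) \<le> Q M l t s b a"
  shows "opt_drivers M l t s b \<le> a"
proof -
  note opt = opt_drivers_maximal[OF assms(1-4), where s=s]
  have "is_arg_max (Q M l t s b) (\<lambda>a. a \<in> actions M) a"
    using assms(5,6) opt(2,3) by (force simp: is_arg_max_linorder)
  then show ?thesis unfolding opt_drivers_def by (rule Least_le)
qed

theorem theorem2:
  fixes M :: "('k::finite, 'd, 'h) store"
  assumes "standing_assumptions M"
  shows "indexable M"
  unfolding indexable_def
proof (intro ballI allI monotone_onI)
  fix t s and b :: "real^'k" and l l' :: real
  assume t: "t \<in> {1..horizon M}" and b: "b \<in> belief_simplex"
    and l: "l \<in> {0..}" "l' \<in> {0..}" "l \<le> l'"
  define a where "a = opt_drivers M l t s b"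
  define a' where "a' = opt_drivers M l' t s b"
  have th: "t \<le> horizon M" and l0: "0 \<le> l" "0 \<le> l'" using t l by auto
  note opt = opt_drivers_maximal[OF assms b l0(1) th, where s=s, folded a_def]
  note opt' = opt_drivers_maximal[OF assms b l0(2) th, where s=s, folded a'_def]
  \<comment> \<open>If \<open>a < a'\<close>, passing from \<open>a\<close> to \<open>a'\<close>
    does not pay at \<open>l\<close>, hence not at \<open>l'\<close> either. Then \<open>a\<close>
    is a maximizer at \<open>l'\<close> too, against the minimality of \<open>a'\<close>.\<close>
  have "a' \<le> a"
  proof (rule ccontr)
    assume "\<not> a' \<le> a"
    then have "Q M l' t s b a' - Q M l' t s b a \<le> Q M l t s b a' - Q M l t s b a"
      using Q_decreasing_differences[OF assms b t l0(1) l(3)] by simp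
    also have "\<dots> \<le> 0" using opt(2) opt(3)[OF opt'(1)] by simp
    finally have "a' \<le> a"
      unfolding a'_def using opt(1) by (intro opt_drivers_le[OF assms b l0(2) th]) auto
    with \<open>\<not> a' \<le> a\<close> show False ..
  qed
  then show "opt_drivers M l' t s b \<le> opt_drivers M l t s b" by (simp add: a_def a'_def)
qed

end
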